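(* Let $q\ge1$ and let $p(y|x_1,x_2,x_3)$, $x_1,x_2,x_3\in\{0,1\}$, $y\in\mathcal Y=\{s_0,\dots,s_{q-1}\}$, be the transition probabilities of a 3-user discrete memoryless multiple access channel. Then the sum rates satisfy $r_s^{TIN}\le r_s^{SC}$, with equality if and only if for all $j=0,1,\dots,q-1$: $$\begin{aligned} (p_{7,s_j}+p_{6,s_j})(p_{1,s_j}+p_{0,s_j})&=(p_{5,s_j}+p_{4,s_j})(p_{3,s_j}+p_{2,s_j}),\\ p_{7,s_j}(p_{4,s_j}+p_{2,s_j}+p_{0,s_j})&=p_{6,s_j}(p_{5,s_j}+p_{3,s_j}+p_{1,s_j}),\\ p_{5,s_j}(p_{6,s_j}+p_{2,s_j}+p_{0,s_j})&=p_{4,s_j}(p_{7,s_j}+p_{3,s_j}+p_{1,s_j}),\\ p_{3,s_j}(p_{6,s_j}+p_{4,s_j}+p_{0,s_j})&=p_{2,s_j}(p_{7,s_j}+p_{5,s_j}+p_{1,s_j}),\\ p_{1,s_j}(p_{6,s_j}+p_{4,s_j}+p_{2,s_j})&=p_{0,s_j}(p_{7,s_j}+p_{5,s_j}+p_{3,s_j}). \end{aligned}$$ Moreover, if $r_s^{TIN}=r_s^{SC}$, then $\mathscr R^{TIN}=\mathscr R^{SC}$ and this rate region is an axis-parallel (possibly degenerate) rectangular box.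
   Context: Write $p_{4x_1+2x_2+x_3,\,y}:=P(Y=y|X_1=x_1,X_2=x_2,X_3=x_3)$. The inputs $X_1,X_2,X_3$ are independent and uniform on $\{0,1\}$, and $Y$ is the channel output; mutual informations are with respect to this joint law, with logarithms to base 2. TIN: $\mathscr R^{TIN}=\{(R_1,R_2,R_3):0\le R_i\le I(X_i;Y),\ i=1,2,3\}$, $r_s^{TIN}=\sum_{i=1}^3 I(X_i;Y)$. SC: $\mathscr R^{SC}$ is the set of $(R_1,R_2,R_3)$ with $R_1,R_2,R_3\ge0$ and $R_1\le I(X_1;Y|X_2,X_3)$, $R_2\le I(X_2;Y|X_1,X_3)$, $R_3\le I(X_3;Y|X_1,X_2)$; $R_1+R_2\le I(X_1,X_2;Y|X_3)$, $R_1+R_3\le I(X_1,X_3;Y|X_2)$, $R_2+R_3\le I(X_2,X_3;Y|X_1)$; $R_1+R_2+R_3\le I(X_1,X_2,X_3;Y)$. Its sum rate is $r_s^{SC}=I(X_1,X_2,X_3;Y)$. *)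

theory Defs
  imports "HOL-Probability.Probability"
begin

text \<open>
  A 3-user discrete memoryless multiple access channel with binary inputs is given by its
  transition kernel: \<open>pmf (W x1 x2 x3) y\<close> is $p(y\,|\,x_1,x_2,x_3)$. The input letters 0 and 1 are
  the Booleans \<open>False\<close> and \<open>True\<close>.
\<close>

type_synonym 'y mac3 = "bool \<Rightarrow> bool \<Rightarrow> bool \<Rightarrow> 'y pmf"

definition joint_law :: "'y mac3 \<Rightarrow> (bool \<times> bool \<times> bool \<times> 'y) pmf" where
  "joint_law W =
    do {
      x1 \<leftarrow> pmf_of_set UNIV;
      x2 \<leftarrow> pmf_of_set UNIV;
      x3 \<leftarrow> pmf_of_set UNIV;
      y \<leftarrow> W x1 x2 x3;
      return_pmf (x1, x2, x3, y)
    }"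

definition X1 :: "bool \<times> bool \<times> bool \<times> 'y \<Rightarrow> bool" where "X1 = (\<lambda>(x1, x2, x3, y). x1)"
definition X2 :: "bool \<times> bool \<times> bool \<times> 'y \<Rightarrow> bool" where "X2 = (\<lambda>(x1, x2, x3, y). x2)"
definition X3 :: "bool \<times> bool \<times> bool \<times> 'y \<Rightarrow> bool" where "X3 = (\<lambda>(x1, x2, x3, y). x3)"
definition Y :: "bool \<times> bool \<times> bool \<times> 'y \<Rightarrow> 'y" where "Y = (\<lambda>(x1, x2, x3, y). y)"

lemma pmf_joint_law: "pmf (joint_law W) (x1, x2, x3, y) = pmf (W x1 x2 x3) y / 8"
proof -
  have *: "pmf (map_pmf (\<lambda>y. (a, b, c, y)) (W a b c)) (x1, x2, x3, y) =
      (if a = x1 \<and> b = x2 \<and> c = x3 then pmf (W x1 x2 x3) y else 0)" for a b c x1 x2 x3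
  proof -
    have "(\<lambda>y. (a, b, c, y)) -` {(x1, x2, x3, y)} =
        (if a = x1 \<and> b = x2 \<and> c = x3 then {y} else {})"
      by auto
    then show ?thesis
      by (simp add: pmf_map measure_pmf_single)
  qed
  show ?thesis
    unfolding joint_law_def map_pmf_def[symmetric]
    by (cases x1; cases x2; cases x3)
       (simp_all add: pmf_bind integral_pmf_of_set UNIV_bool *)
qed

text \<open>\<open>trans_prob W (4 * x1 + 2 * x2 + x3) y\<close> is $p_{4x_1+2x_2+x_3,\,y}$: the binary digits of
  the index are the input letters.\<close>

definition trans_prob :: "'y mac3 \<Rightarrow> nat \<Rightarrow> 'y \<Rightarrow> real" where
  "trans_prob W k y = pmf (W (bit k 2) (bit k 1) (bit k 0)) y"

lemma trans_prob_index:
  "trans_prob W (4 * of_bool x1 + 2 * of_bool x2 + of_bool x3) y = pmf (W x1 x2 x3) y"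
  by (cases x1; cases x2; cases x3) (simp_all add: trans_prob_def bit_iff_odd)

lemma trans_prob_eq_cond_prob:
  "trans_prob W (4 * of_bool x1 + 2 * of_bool x2 + of_bool x3) y =
     \<P>(\<omega> in measure_pmf (joint_law W). Y \<omega> = y \<bar> X1 \<omega> = x1 \<and> X2 \<omega> = x2 \<and> X3 \<omega> = x3)"
proof -
  have *: "measure_pmf.prob (joint_law W) {\<omega>. X1 \<omega> = x1 \<and> X2 \<omega> = x2 \<and> X3 \<omega> = x3} = 1 / 8"
  proof -
    have "map_pmf (\<lambda>\<omega>. (X1 \<omega>, X2 \<omega>, X3 \<omega>)) (joint_law W) =
        do {x1 \<leftarrow> pmf_of_set UNIV; x2 \<leftarrow> pmf_of_set UNIV; x3 \<leftarrow> pmf_of_set UNIV;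
            return_pmf (x1, x2, x3)}"
      by (simp add: joint_law_def map_bind_pmf X1_def X2_def X3_def)
    then have "pmf (map_pmf (\<lambda>\<omega>. (X1 \<omega>, X2 \<omega>, X3 \<omega>)) (joint_law W)) (x1, x2, x3) = 1 / 8"
      by (cases x1; cases x2; cases x3)
         (simp_all add: pmf_bind integral_pmf_of_set UNIV_bool)
    then show ?thesis
      by (simp add: pmf_map vimage_def conj_commute)
  qed
  have **: "{\<omega>. Y \<omega> = y \<and> X1 \<omega> = x1 \<and> X2 \<omega> = x2 \<and> X3 \<omega> = x3} = {(x1, x2, x3, y)}"
    by (auto simp: X1_def X2_def X3_def Y_def)
  show ?thesis
    by (simp add: * ** cond_prob_def trans_prob_index pmf_joint_law measure_pmf_single)
qed

text \<open>Mutual information in bits, with the discrete \<open>\<sigma>\<close>-algebras, as in the notations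
  \<open>\<I>(A ; B)\<close> and \<open>\<I>(A ; B | C)\<close> of \<^locale>\<open>information_space\<close>.\<close>

definition mi :: "'a pmf \<Rightarrow> ('a \<Rightarrow> 'b) \<Rightarrow> ('a \<Rightarrow> 'c) \<Rightarrow> real" where
  "mi M A B = prob_space.mutual_information (measure_pmf M) 2
     (count_space (range A)) (count_space (range B)) A B"

definition cmi :: "'a pmf \<Rightarrow> ('a \<Rightarrow> 'b) \<Rightarrow> ('a \<Rightarrow> 'c) \<Rightarrow> ('a \<Rightarrow> 'd) \<Rightarrow> real" where
  "cmi M A B C = prob_space.conditional_mutual_information (measure_pmf M) 2
     (count_space (range A)) (count_space (range B)) (count_space (range C)) A B C"

abbreviation pair_rv :: "('a \<Rightarrow> 'b) \<Rightarrow> ('a \<Rightarrow> 'c) \<Rightarrow> 'a \<Rightarrow> 'b \<times> 'c" where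
  "pair_rv A B \<equiv> (\<lambda>\<omega>. (A \<omega>, B \<omega>))"

definition TIN_region :: "'y mac3 \<Rightarrow> (real \<times> real \<times> real) set" where
  "TIN_region W = {(R1, R2, R3).
     0 \<le> R1 \<and> R1 \<le> mi (joint_law W) X1 Y \<and>
     0 \<le> R2 \<and> R2 \<le> mi (joint_law W) X2 Y \<and>
     0 \<le> R3 \<and> R3 \<le> mi (joint_law W) X3 Y}"

definition TIN_sum_rate :: "'y mac3 \<Rightarrow> real" where
  "TIN_sum_rate W = mi (joint_law W) X1 Y + mi (joint_law W) X2 Y + mi (joint_law W) X3 Y"

definition SC_region :: "'y mac3 \<Rightarrow> (real \<times> real \<times> real) set" where
  "SC_region W = {(R1, R2, R3).
     0 \<le> R1 \<and> 0 \<le> R2 \<and> 0 \<le> R3 \<and>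
     R1 \<le> cmi (joint_law W) X1 Y (pair_rv X2 X3) \<and>
     R2 \<le> cmi (joint_law W) X2 Y (pair_rv X1 X3) \<and>
     R3 \<le> cmi (joint_law W) X3 Y (pair_rv X1 X2) \<and>
     R1 + R2 \<le> cmi (joint_law W) (pair_rv X1 X2) Y X3 \<and>
     R1 + R3 \<le> cmi (joint_law W) (pair_rv X1 X3) Y X2 \<and>
     R2 + R3 \<le> cmi (joint_law W) (pair_rv X2 X3) Y X1 \<and>
     R1 + R2 + R3 \<le> mi (joint_law W) (pair_rv X1 (pair_rv X2 X3)) Y}"

definition SC_sum_rate :: "'y mac3 \<Rightarrow> real" where
  "SC_sum_rate W = mi (joint_law W) (pair_rv X1 (pair_rv X2 X3)) Y"

text \<open>A nonempty closed box; it may be degenerate, i.e. have sides of length 0.\<close>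

definition axis_parallel_box :: "'a::euclidean_space set \<Rightarrow> bool" where
  "axis_parallel_box S \<longleftrightarrow> S \<noteq> {} \<and> (\<exists>l u. S = cbox l u)"

end

theory Submission
  imports Defs
begin

text \<open>
  Given \<open>Y = y\<close>, the input triple is distributed proportionally to the table
  \<open>p(y | x\<^sub>1, x\<^sub>2, x\<^sub>3)\<close>. As the inputs are independent, the gap
  \<open>I(X\<^sub>1,X\<^sub>2,X\<^sub>3;Y) - (I(X\<^sub>1;Y) + I(X\<^sub>2;Y) + I(X\<^sub>3;Y))\<close> is the Kullback-Leibler divergence of the joint law from
  \<open>P(y) P(x\<^sub>1|y) P(x\<^sub>2|y) P(x\<^sub>3|y)\<close>. By Gibbs' inequality it is nonnegative, and it vanishes iff
  the inputs are conditionally independent given \<open>Y\<close>. The five polynomial identities say the same: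
  the first one is a vanishing \<open>2 \<times> 2\<close> determinant, which makes \<open>X\<^sub>1\<close> and \<open>X\<^sub>2\<close> independent given
  \<open>y\<close>, and the other four, after adding the missing term to both sides, make \<open>X\<^sub>3\<close> independent of
  \<open>(X\<^sub>1, X\<^sub>2)\<close> given \<open>y\<close>. Under conditional independence every bound defining
  \<open>\<R>\<^sup>S\<^sup>C\<close> is the sum of the single-user bounds, so both regions are the same box.
\<close>

section \<open>Gibbs' inequality with its equality case\<close>

text \<open>From \<open>ln t <= t - 1\<close> at \<open>t = q x / p x\<close>, each term satisfies
  \<open>p x * ln (p x / q x) >= p x - q x\<close>, with equality only for \<open>p x = q x\<close>.
  Summing leaves \<open>sum p A - sum q A >= 0\<close>, and a vanishing sum forces equality in every
  term.\<close>

lemma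
  fixes p q :: "'a \<Rightarrow> real"
  assumes "1 < b" "finite A" and nn: "\<And>x. x \<in> A \<Longrightarrow> 0 \<le> p x" "\<And>x. x \<in> A \<Longrightarrow> 0 \<le> q x"
    and ac: "\<And>x. x \<in> A \<Longrightarrow> 0 < p x \<Longrightarrow> 0 < q x"
    and le: "sum q A \<le> sum p A"
  shows gibbs_inequality: "0 \<le> (\<Sum>x\<in>A. p x * log b (p x / q x))"
    and gibbs_equality: "(\<Sum>x\<in>A. p x * log b (p x / q x)) = 0 \<longleftrightarrow> (\<forall>x\<in>A. p x = q x)"
proof -
  \<comment> \<open>\<open>f\<close> is the slack of the termwise bound; for \<open>p x > 0\<close>
    it equals \<open>p x * (t - 1 - ln t)\<close> with \<open>t = q x / p x\<close>.\<close>
  define f where "f x = p x * ln (p x / q x) - (p x - q x)" for x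
  have sum_f: "(\<Sum>x\<in>A. p x * ln (p x / q x)) = sum f A + (sum p A - sum q A)"
    by (simp add: f_def sum_subtractf)
  have f: "0 \<le> f x \<and> (f x = 0 \<longrightarrow> p x = q x)" if "x \<in> A" for x
  proof (cases "p x = 0")
    case False
    then have pos: "0 < p x" "0 < q x" using nn(1)[OF that] ac[OF that] by auto
    have "ln (p x / q x) = - ln (q x / p x)"
      using pos by (simp add: ln_div)
    then have f_eq: "f x = p x * (q x / p x - 1 - ln (q x / p x))"
      using pos by (simp add: f_def algebra_simps)
    have "q x / p x = 1" if "ln (q x / p x) = q x / p x - 1"
      using ln_eq_minus_one[OF _ that] pos by simp
    moreover have "ln (q x / p x) \<le> q x / p x - 1"
      using pos by (intro ln_le_minus_one) simp
    ultimately show ?thesis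
      using pos by (auto simp: f_eq)
  qed (use nn(2)[OF that] in \<open>auto simp: f_def\<close>)
  have eq: "(\<Sum>x\<in>A. p x * log b (p x / q x)) = (\<Sum>x\<in>A. p x * ln (p x / q x)) / ln b"
    by (simp add: log_def sum_divide_distrib)
  have b: "0 < ln b" using \<open>1 < b\<close> by simp
  have f_nn: "0 \<le> sum f A"
    using f by (simp add: sum_nonneg)
  show "0 \<le> (\<Sum>x\<in>A. p x * log b (p x / q x))"
    unfolding eq sum_f using f_nn le b by simp
  show "(\<Sum>x\<in>A. p x * log b (p x / q x)) = 0 \<longleftrightarrow> (\<forall>x\<in>A. p x = q x)"
  proof
    assume "(\<Sum>x\<in>A. p x * log b (p x / q x)) = 0"
    then have "sum f A = 0"
      unfolding eq sum_f using f_nn le b by simp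
    then have "\<forall>x\<in>A. f x = 0"
      using sum_nonneg_eq_0_iff[OF \<open>finite A\<close>, of f] f by blast
    with f show "\<forall>x\<in>A. p x = q x" by blast
  qed (auto intro!: sum.neutral)
qed

section \<open>Mutual informations as finite sums\<close>

lemma information_space_pmf: "information_space (measure_pmf M) 2"
  by (simp add: information_space_axioms_def information_space_def prob_space_measure_pmf)

lemma simple_distributed_pmf:
  fixes M :: "'a::finite pmf"
  shows "simple_distributed (measure_pmf M) f (pmf (map_pmf f M))"
  by (rule measure_pmf.simple_distributedI) (auto simp: simple_function_def pmf_map)

text \<open>Change of variables: sums over the values of a random variable become sums over
  outcomes. All informations then share one index set and can be compared term by term.\<close>

lemma sum_pmf_map:
  fixes M :: "'a::finite pmf" and g :: "'b \<Rightarrow> real"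
  shows "(\<Sum>z\<in>range f. pmf (map_pmf f M) z * g z) = (\<Sum>\<omega>\<in>UNIV. pmf M \<omega> * g (f \<omega>))"
proof -
  have "pmf (map_pmf f M) z = (\<Sum>\<omega> | \<omega> \<in> UNIV \<and> f \<omega> = z. pmf M \<omega>)" for z
    by (simp add: pmf_map measure_measure_pmf_finite vimage_def)
  then have "(\<Sum>z\<in>range f. pmf (map_pmf f M) z * g z) =
      (\<Sum>z\<in>range f. \<Sum>\<omega> | \<omega> \<in> UNIV \<and> f \<omega> = z. pmf M \<omega> * g (f \<omega>))"
    by (simp add: sum_distrib_right)
  then show ?thesis
    using sum.image_gen[of UNIV "\<lambda>\<omega>. pmf M \<omega> * g (f \<omega>)" f] by simp
qed

lemma mi_eq_sum:
  fixes M :: "'a::finite pmf"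
  shows "mi M A B = (\<Sum>\<omega>\<in>UNIV. pmf M \<omega> *
    log 2 (pmf (map_pmf (pair_rv A B) M) (A \<omega>, B \<omega>) /
      (pmf (map_pmf A M) (A \<omega>) * pmf (map_pmf B M) (B \<omega>))))"
proof -
  interpret information_space "measure_pmf M" 2 by (rule information_space_pmf)
  show ?thesis
    using mutual_information_simple_distributed[OF simple_distributed_pmf[of M A]
        simple_distributed_pmf[of M B] simple_distributed_pmf[of M "pair_rv A B"]]
    by (simp add: mi_def case_prod_beta sum_pmf_map)
qed

lemma cmi_eq_sum:
  fixes M :: "'a::finite pmf"
  shows "cmi M A B C = (\<Sum>\<omega>\<in>UNIV. pmf M \<omega> *
    log 2 (pmf (map_pmf (pair_rv A (pair_rv B C)) M) (A \<omega>, B \<omega>, C \<omega>) /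
      (pmf (map_pmf (pair_rv A C) M) (A \<omega>, C \<omega>) *
        (pmf (map_pmf (pair_rv B C) M) (B \<omega>, C \<omega>) / pmf (map_pmf C M) (C \<omega>)))))"
proof -
  interpret information_space "measure_pmf M" 2 by (rule information_space_pmf)
  show ?thesis
    using conditional_mutual_information_eq[OF simple_distributed_pmf[of M C]
        simple_distributed_pmf[of M "pair_rv B C"] simple_distributed_pmf[of M "pair_rv A C"]
        simple_distributed_pmf[of M "pair_rv A (pair_rv B C)"]]
    by (simp add: cmi_def case_prod_beta sum_pmf_map)
qed

lemma mi_nonneg:
  fixes M :: "'a::finite pmf"
  shows "0 \<le> mi M A B"
proof -
  interpret information_space "measure_pmf M" 2 by (rule information_space_pmf)
  show ?thesis
    using mutual_information_nonneg_simple[of A B] by (simp add: mi_def simple_function_def)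
qed

section \<open>Product tables and their marginals\<close>

type_synonym table = "bool \<Rightarrow> bool \<Rightarrow> bool \<Rightarrow> real"

definition mass :: "table \<Rightarrow> real" where "mass c = (\<Sum>i\<in>UNIV. \<Sum>j\<in>UNIV. \<Sum>k\<in>UNIV. c i j k)"
definition marg1 :: "table \<Rightarrow> bool \<Rightarrow> real" where "marg1 c i = (\<Sum>j\<in>UNIV. \<Sum>k\<in>UNIV. c i j k)"
definition marg2 :: "table \<Rightarrow> bool \<Rightarrow> real" where "marg2 c j = (\<Sum>i\<in>UNIV. \<Sum>k\<in>UNIV. c i j k)"
definition marg3 :: "table \<Rightarrow> bool \<Rightarrow> real" where "marg3 c k = (\<Sum>i\<in>UNIV. \<Sum>j\<in>UNIV. c i j k)"
definition marg12 :: "table \<Rightarrow> bool \<Rightarrow> bool \<Rightarrow> real" where "marg12 c i j = (\<Sum>k\<in>UNIV. c i j k)"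
definition marg13 :: "table \<Rightarrow> bool \<Rightarrow> bool \<Rightarrow> real" where "marg13 c i k = (\<Sum>j\<in>UNIV. c i j k)"
definition marg23 :: "table \<Rightarrow> bool \<Rightarrow> bool \<Rightarrow> real" where "marg23 c j k = (\<Sum>i\<in>UNIV. c i j k)"

lemmas marg_defs = mass_def marg1_def marg2_def marg3_def marg12_def marg13_def marg23_def

text \<open>Independence of the three coordinates under the normalised table
  \<open>c / mass c\<close>. Denominators are cleared so that the zero table, which comes from an
  output letter of probability 0, qualifies.\<close>

definition product_table :: "table \<Rightarrow> bool" where
  "product_table c \<longleftrightarrow>
    (\<forall>i j k. c i j k * (mass c)\<^sup>2 = marg1 c i * marg2 c j * marg3 c k)"

lemma mass_eq_0_iff:
  assumes "\<And>i j k. 0 \<le> c i j k"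
  shows "mass c = 0 \<longleftrightarrow> (\<forall>i j k. c i j k = 0)"
  using assms by (simp add: mass_def sum_nonneg_eq_0_iff sum_nonneg)

lemma marg_pos:
  assumes "\<And>i j k. 0 \<le> c i j k" "0 < c i j k"
  shows "0 < mass c" "0 < marg1 c i" "0 < marg2 c j" "0 < marg3 c k"
    "0 < marg12 c i j" "0 < marg13 c i k" "0 < marg23 c j k"
  using assms unfolding marg_defs
  by (cases i; cases j; cases k; simp add: UNIV_bool add_nonneg_pos add_pos_nonneg)+

lemma sum_marg:
  "(\<Sum>i\<in>UNIV. marg1 c i) = mass c" "(\<Sum>j\<in>UNIV. marg2 c j) = mass c"
  "(\<Sum>k\<in>UNIV. marg3 c k) = mass c"
  by (simp_all add: marg_defs UNIV_bool)

lemma sum_product_marg: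
  "(\<Sum>i\<in>UNIV. \<Sum>j\<in>UNIV. \<Sum>k\<in>UNIV. marg1 c i * marg2 c j * marg3 c k) = mass c ^ 3"
  by (simp add: sum_distrib_left[symmetric] sum_distrib_right[symmetric] sum_marg power3_eq_cube)

text \<open>Summing the product identity over one coordinate turns that marginal into
  \<open>mass c\<close>; then one factor \<open>mass c\<close> is cancelled.\<close>

lemma product_table_marg:
  assumes "\<And>i j k. 0 \<le> c i j k" "product_table c"
  shows "marg12 c i j * mass c = marg1 c i * marg2 c j"
    and "marg13 c i k * mass c = marg1 c i * marg3 c k"
    and "marg23 c j k * mass c = marg2 c j * marg3 c k"
proof -
  have *: "c i j k * (mass c)\<^sup>2 = marg1 c i * marg2 c j * marg3 c k" for i j k
    using assms(2) by (simp add: product_table_def)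
  have "marg12 c i j * (mass c)\<^sup>2 = marg1 c i * marg2 c j * (\<Sum>k\<in>UNIV. marg3 c k)"
       "marg13 c i k * (mass c)\<^sup>2 = marg1 c i * marg3 c k * (\<Sum>j\<in>UNIV. marg2 c j)"
       "marg23 c j k * (mass c)\<^sup>2 = marg2 c j * marg3 c k * (\<Sum>i\<in>UNIV. marg1 c i)"
    unfolding marg12_def marg13_def marg23_def sum_distrib_right sum_distrib_left *
    by (simp_all add: mult_ac)
  note marg = this[unfolded sum_marg]
  have zero: "c = (\<lambda>_ _ _. 0)" if "mass c = 0"
    using that assms(1) by (simp add: mass_eq_0_iff fun_eq_iff)
  \<comment> \<open>When \<open>mass c = 0\<close> nothing can be cancelled, but nonnegativity then
    makes the whole table zero.\<close>
  have cancel: "x * mass c = z" if "x * (mass c)\<^sup>2 = z * mass c" "c = (\<lambda>_ _ _. 0) \<Longrightarrow> z = 0" for x z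
    using that zero by (cases "mass c = 0") (simp_all add: power2_eq_square)
  show "marg12 c i j * mass c = marg1 c i * marg2 c j"
    by (rule cancel[OF marg(1)]) (simp add: marg1_def)
  show "marg13 c i k * mass c = marg1 c i * marg3 c k"
    by (rule cancel[OF marg(2)]) (simp add: marg1_def)
  show "marg23 c j k * mass c = marg2 c j * marg3 c k"
    by (rule cancel[OF marg(3)]) (simp add: marg2_def)
qed

text \<open>The right-hand side splits independence in two: a rank-one condition on the first two
  coordinates, and odds of the third coordinate that are the same for all
  \<open>i j\<close>.\<close>

lemma product_table_iff:
  assumes nn: "\<And>i j k. 0 \<le> c i j k"
  shows "product_table c \<longleftrightarrow>
    marg12 c True True * marg12 c False False = marg12 c True False * marg12 c False True \<and>
    (\<forall>i j. c i j True * marg3 c False = c i j False * marg3 c True)"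
    (is "_ \<longleftrightarrow> ?R")
proof
  assume pt: "product_table c"
  show ?R
  proof (cases "mass c = 0")
    case True
    then have "c = (\<lambda>_ _ _. 0)" using nn by (simp add: mass_eq_0_iff fun_eq_iff)
    then show ?thesis by (simp add: marg_defs)
  next
    case False
    \<comment> \<open>Scaled by powers of \<open>mass c\<close>, both sides of each identity become
      the same product of marginals; the powers cancel since \<open>mass c\<close> is
      nonzero.\<close>
    have "(marg12 c True True * mass c) * (marg12 c False False * mass c) =
        (marg12 c True False * mass c) * (marg12 c False True * mass c)"
      using nn pt by (simp add: product_table_marg)
    moreover have "(c i j True * (mass c)\<^sup>2) * marg3 c False = (c i j False * (mass c)\<^sup>2) * marg3 c True" for i j
      using pt by (simp add: product_table_def)
    ultimately show ?thesis using False by (simp add: power2_eq_square)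
  qed
next
  assume R: ?R
  have last: "c i j k * mass c = marg12 c i j * marg3 c k" for i j k
  proof -
    have "c i j True * marg3 c False = c i j False * marg3 c True" using R by blast
    moreover have "mass c = marg3 c True + marg3 c False" by (simp add: marg_defs UNIV_bool)
    ultimately show ?thesis by (cases k) (simp_all add: marg12_def UNIV_bool algebra_simps)
  qed
  \<comment> \<open>In the four entries of \<open>marg12 c\<close>, the two sides differ by plus or
    minus the \<open>2 x 2\<close> determinant.\<close>
  have first: "marg12 c i j * mass c = marg1 c i * marg2 c j" for i j
  proof -
    have *: "mass c = marg12 c True True + marg12 c True False + marg12 c False True + marg12 c False False"
      "\<And>i. marg1 c i = marg12 c i True + marg12 c i False"
      "\<And>j. marg2 c j = marg12 c True j + marg12 c False j"
      by (simp_all add: marg_defs UNIV_bool)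
    show ?thesis
      using R unfolding * by (cases i; cases j; simp add: algebra_simps)
  qed
  have "c i j k * (mass c)\<^sup>2 = marg1 c i * marg2 c j * marg3 c k" for i j k
  proof -
    have "c i j k * (mass c)\<^sup>2 = (c i j k * mass c) * mass c"
      by (simp add: power2_eq_square)
    also have "\<dots> = (marg12 c i j * mass c) * marg3 c k"
      by (simp add: last)
    finally show ?thesis by (simp add: first)
  qed
  then show "product_table c"
    by (simp add: product_table_def)
qed

section \<open>Marginals of the joint law\<close>

abbreviation slice :: "'y mac3 \<Rightarrow> 'y \<Rightarrow> table" where
  "slice W y \<equiv> \<lambda>i j k. pmf (W i j k) y"

lemma pmf_map_joint_law:
  "pmf (map_pmf f (joint_law W)) z =
    (\<Sum>i\<in>UNIV. \<Sum>j\<in>UNIV. \<Sum>k\<in>UNIV. pmf (map_pmf (\<lambda>y. f (i, j, k, y)) (W i j k)) z) / 8"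
proof -
  have "map_pmf f (joint_law W) =
      do {
        i \<leftarrow> pmf_of_set UNIV;
        j \<leftarrow> pmf_of_set UNIV;
        k \<leftarrow> pmf_of_set UNIV;
        map_pmf (\<lambda>y. f (i, j, k, y)) (W i j k)
      }"
    by (simp add: joint_law_def map_pmf_def bind_assoc_pmf bind_return_pmf)
  then show ?thesis
    by (simp add: pmf_bind integral_pmf_of_set UNIV_bool add_divide_distrib)
qed

text \<open>Once the inputs are fixed, every tuple of coordinates used here is constant or is the
  output letter tagged with constants, so the preimage of a point is a singleton or empty for each
  tagged form.\<close>

lemma pmf_map_tag:
  "pmf (map_pmf (\<lambda>y. a) N) a' = (if a = a' then 1 else 0)"
  "pmf (map_pmf (\<lambda>y. (a, y)) N) (a', y') = (if a = a' then pmf N y' else 0)"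
  "pmf (map_pmf (\<lambda>y. (y, b)) N) (y', b') = (if b = b' then pmf N y' else 0)"
  "pmf (map_pmf (\<lambda>y. (a, y, b)) N) (a', y', b') = (if a = a' \<and> b = b' then pmf N y' else 0)"
proof -
  have "(\<lambda>y. (a, y)) -` {(a', y')} = (if a = a' then {y'} else {})"
    "(\<lambda>y. (y, b)) -` {(y', b')} = (if b = b' then {y'} else {})"
    "(\<lambda>y. (a, y, b)) -` {(a', y', b')} = (if a = a' \<and> b = b' then {y'} else {})"
    by auto
  then show "pmf (map_pmf (\<lambda>y. a) N) a' = (if a = a' then 1 else 0)"
    "pmf (map_pmf (\<lambda>y. (a, y)) N) (a', y') = (if a = a' then pmf N y' else 0)"
    "pmf (map_pmf (\<lambda>y. (y, b)) N) (y', b') = (if b = b' then pmf N y' else 0)"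
    "pmf (map_pmf (\<lambda>y. (a, y, b)) N) (a', y', b') = (if a = a' \<and> b = b' then pmf N y' else 0)"
    by (simp_all add: pmf_map measure_pmf_single)
qed

lemmas coord_defs = X1_def X2_def X3_def Y_def

lemma coord_apply:
  "X1 (i, j, k, y) = i" "X2 (i, j, k, y) = j" "X3 (i, j, k, y) = k" "Y (i, j, k, y) = y"
  by (simp_all add: coord_defs)

lemma pmf_inputs:
  "pmf (map_pmf X1 (joint_law W)) i = 1 / 2"
  "pmf (map_pmf X2 (joint_law W)) j = 1 / 2"
  "pmf (map_pmf X3 (joint_law W)) k = 1 / 2"
  "pmf (map_pmf (pair_rv X1 X2) (joint_law W)) (i, j) = 1 / 4"
  "pmf (map_pmf (pair_rv X1 X3) (joint_law W)) (i, k) = 1 / 4"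
  "pmf (map_pmf (pair_rv X2 X3) (joint_law W)) (j, k) = 1 / 4"
  "pmf (map_pmf (pair_rv X1 (pair_rv X2 X3)) (joint_law W)) (i, j, k) = 1 / 8"
  "pmf (map_pmf (pair_rv X2 (pair_rv X1 X3)) (joint_law W)) (j, i, k) = 1 / 8"
  "pmf (map_pmf (pair_rv X3 (pair_rv X1 X2)) (joint_law W)) (k, i, j) = 1 / 8"
  "pmf (map_pmf (pair_rv (pair_rv X1 X2) X3) (joint_law W)) ((i, j), k) = 1 / 8"
  "pmf (map_pmf (pair_rv (pair_rv X1 X3) X2) (joint_law W)) ((i, k), j) = 1 / 8"
  "pmf (map_pmf (pair_rv (pair_rv X2 X3) X1) (joint_law W)) ((j, k), i) = 1 / 8"
  \<comment> \<open>Removing \<open>map_pmf_const\<close> keeps constant maps in the form that the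
    first rule of \<open>pmf_map_tag\<close> matches.\<close>
  by (simp_all add: coord_defs pmf_map_joint_law UNIV_bool pmf_map_tag del: map_pmf_const)

lemma pmf_inputs_output:
  "pmf (map_pmf Y (joint_law W)) y = mass (slice W y) / 8"
  "pmf (map_pmf (pair_rv X1 Y) (joint_law W)) (i, y) = marg1 (slice W y) i / 8"
  "pmf (map_pmf (pair_rv X2 Y) (joint_law W)) (j, y) = marg2 (slice W y) j / 8"
  "pmf (map_pmf (pair_rv X3 Y) (joint_law W)) (k, y) = marg3 (slice W y) k / 8"
  "pmf (map_pmf (pair_rv Y X1) (joint_law W)) (y, i) = marg1 (slice W y) i / 8"
  "pmf (map_pmf (pair_rv Y X2) (joint_law W)) (y, j) = marg2 (slice W y) j / 8"
  "pmf (map_pmf (pair_rv Y X3) (joint_law W)) (y, k) = marg3 (slice W y) k / 8"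
  "pmf (map_pmf (pair_rv Y (pair_rv X1 X2)) (joint_law W)) (y, i, j) = marg12 (slice W y) i j / 8"
  "pmf (map_pmf (pair_rv Y (pair_rv X1 X3)) (joint_law W)) (y, i, k) = marg13 (slice W y) i k / 8"
  "pmf (map_pmf (pair_rv Y (pair_rv X2 X3)) (joint_law W)) (y, j, k) = marg23 (slice W y) j k / 8"
  "pmf (map_pmf (pair_rv X1 (pair_rv Y (pair_rv X2 X3))) (joint_law W)) (i, y, j, k) = slice W y i j k / 8"
  "pmf (map_pmf (pair_rv X2 (pair_rv Y (pair_rv X1 X3))) (joint_law W)) (j, y, i, k) = slice W y i j k / 8"
  "pmf (map_pmf (pair_rv X3 (pair_rv Y (pair_rv X1 X2))) (joint_law W)) (k, y, i, j) = slice W y i j k / 8"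
  "pmf (map_pmf (pair_rv (pair_rv X1 X2) (pair_rv Y X3)) (joint_law W)) ((i, j), y, k) = slice W y i j k / 8"
  "pmf (map_pmf (pair_rv (pair_rv X1 X3) (pair_rv Y X2)) (joint_law W)) ((i, k), y, j) = slice W y i j k / 8"
  "pmf (map_pmf (pair_rv (pair_rv X2 X3) (pair_rv Y X1)) (joint_law W)) ((j, k), y, i) = slice W y i j k / 8"
  "pmf (map_pmf (pair_rv (pair_rv X1 (pair_rv X2 X3)) Y) (joint_law W)) ((i, j, k), y) = slice W y i j k / 8"
  by (simp_all add: coord_defs pmf_map_joint_law UNIV_bool pmf_map_tag marg_defs)


section \<open>Informations as expected logarithms\<close>

definition expected_log :: "('y::finite) mac3 \<Rightarrow> (bool \<Rightarrow> bool \<Rightarrow> bool \<Rightarrow> 'y \<Rightarrow> real) \<Rightarrow> real" where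
  "expected_log W g = (\<Sum>(i, j, k, y)\<in>UNIV. pmf (W i j k) y / 8 * log 2 (g i j k y))"

text \<open>Points of probability 0 contribute 0 whatever the logarithm is there, so ratios need to
  agree only on the support, where all denominators are positive.\<close>

lemma expected_log_cong:
  assumes "\<And>i j k y. 0 < pmf (W i j k) y \<Longrightarrow> g i j k y = h i j k y"
  shows "expected_log W g = expected_log W h"
proof -
  have "pmf (W i j k) y / 8 * log 2 (g i j k y) = pmf (W i j k) y / 8 * log 2 (h i j k y)"
    for i j k y
    using assms[of i j k y, OF pmf_pos] by (cases "pmf (W i j k) y = 0") simp_all
  then show ?thesis
    by (simp only: expected_log_def)
qed

lemma expected_log_mult:
  assumes "\<And>i j k y. 0 < pmf (W i j k) y \<Longrightarrow> 0 < g i j k y \<and> 0 < h i j k y"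
  shows "expected_log W (\<lambda>i j k y. g i j k y * h i j k y) = expected_log W g + expected_log W h"
proof -
  have "pmf (W i j k) y / 8 * log 2 (g i j k y * h i j k y) =
      pmf (W i j k) y / 8 * log 2 (g i j k y) + pmf (W i j k) y / 8 * log 2 (h i j k y)"
    for i j k y
    using assms[of i j k y, OF pmf_pos]
    by (cases "pmf (W i j k) y = 0") (simp_all add: log_mult_pos distrib_left)
  then show ?thesis
    by (simp only: expected_log_def case_prod_beta' sum.distrib)
qed

text \<open>The factors 2 and 8 are the reciprocals of the input probabilities \<open>1 / 2\<close>
  and \<open>1 / 8\<close>.\<close>

lemma mi_joint_law:
  fixes W :: "('y::finite) mac3"
  shows "mi (joint_law W) X1 Y =
      expected_log W (\<lambda>i j k y. 2 * marg1 (slice W y) i / mass (slice W y))"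
    and "mi (joint_law W) X2 Y =
      expected_log W (\<lambda>i j k y. 2 * marg2 (slice W y) j / mass (slice W y))"
    and "mi (joint_law W) X3 Y =
      expected_log W (\<lambda>i j k y. 2 * marg3 (slice W y) k / mass (slice W y))"
    and "mi (joint_law W) (pair_rv X1 (pair_rv X2 X3)) Y =
      expected_log W (\<lambda>i j k y. 8 * slice W y i j k / mass (slice W y))"
  unfolding mi_eq_sum expected_log_def
  by (rule sum.cong; clarsimp simp: coord_apply pmf_joint_law pmf_inputs pmf_inputs_output)+

text \<open>By independence of the inputs the constant is again the reciprocal probability of the
  unconditioned inputs: 2 for one input, 4 for a pair.\<close>

lemma cmi_joint_law:
  fixes W :: "('y::finite) mac3"
  shows "cmi (joint_law W) X1 Y (pair_rv X2 X3) =
      expected_log W (\<lambda>i j k y. 2 * slice W y i j k / marg23 (slice W y) j k)"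
    and "cmi (joint_law W) X2 Y (pair_rv X1 X3) =
      expected_log W (\<lambda>i j k y. 2 * slice W y i j k / marg13 (slice W y) i k)"
    and "cmi (joint_law W) X3 Y (pair_rv X1 X2) =
      expected_log W (\<lambda>i j k y. 2 * slice W y i j k / marg12 (slice W y) i j)"
    and "cmi (joint_law W) (pair_rv X1 X2) Y X3 =
      expected_log W (\<lambda>i j k y. 4 * slice W y i j k / marg3 (slice W y) k)"
    and "cmi (joint_law W) (pair_rv X1 X3) Y X2 =
      expected_log W (\<lambda>i j k y. 4 * slice W y i j k / marg2 (slice W y) j)"
    and "cmi (joint_law W) (pair_rv X2 X3) Y X1 =
      expected_log W (\<lambda>i j k y. 4 * slice W y i j k / marg1 (slice W y) i)"
  unfolding cmi_eq_sum expected_log_def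
  by (rule sum.cong; clarsimp simp: coord_apply pmf_joint_law pmf_inputs pmf_inputs_output)+

lemma slice_pos:
  assumes "0 < pmf (W i j k) y"
  shows "0 < mass (slice W y)" "0 < marg1 (slice W y) i" "0 < marg2 (slice W y) j"
    "0 < marg3 (slice W y) k" "0 < marg12 (slice W y) i j" "0 < marg13 (slice W y) i k"
    "0 < marg23 (slice W y) j k"
  using marg_pos[of "slice W y" i j k] assms by simp_all

section \<open>The sum rate gap as a divergence\<close>

text \<open>\<open>r\<close> is \<open>P(y) P(x1|y) P(x2|y) P(x3|y)\<close>. The joint information
  density factors into the three single-user densities times \<open>p / r\<close>, and the logarithm
  turns this into a sum.\<close>

lemma sum_rate_gap:
  fixes W :: "('y::finite) mac3"
  defines "p \<equiv> \<lambda>(i, j, k, y). pmf (W i j k) y / 8"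
    and "r \<equiv> \<lambda>(i, j, k, y). marg1 (slice W y) i * marg2 (slice W y) j * marg3 (slice W y) k /
      (8 * (mass (slice W y))\<^sup>2)"
  shows "SC_sum_rate W - TIN_sum_rate W = (\<Sum>\<omega>\<in>UNIV. p \<omega> * log 2 (p \<omega> / r \<omega>))"
proof -
  let ?f1 = "\<lambda>i j k y. 2 * marg1 (slice W y) i / mass (slice W y)"
    and ?f2 = "\<lambda>i j k y. 2 * marg2 (slice W y) j / mass (slice W y)"
    and ?f3 = "\<lambda>i j k y. 2 * marg3 (slice W y) k / mass (slice W y)"
    and ?g = "\<lambda>i j k y. p (i, j, k, y) / r (i, j, k, y)"
  have pos: "0 < ?f1 i j k y" "0 < ?f2 i j k y" "0 < ?f3 i j k y" "0 < ?g i j k y"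
    if "0 < pmf (W i j k) y" for i j k y
    using slice_pos[of W i j k y] that by (simp_all add: p_def r_def)
  have eq: "8 * x / t = (2 * a / t) * ((2 * b / t) * ((2 * c / t) * ((x / 8) / (a * b * c / (8 * t\<^sup>2)))))"
    if "0 < t" "0 < a" "0 < b" "0 < c" for x t a b c :: real
    using that by (simp add: power2_eq_square)
  have "SC_sum_rate W =
      expected_log W (\<lambda>i j k y. ?f1 i j k y * (?f2 i j k y * (?f3 i j k y * ?g i j k y)))"
    unfolding SC_sum_rate_def mi_joint_law p_def r_def prod.case
    by (rule expected_log_cong) (rule eq; rule slice_pos)
  also have "\<dots> = expected_log W ?f1 + (expected_log W ?f2 + (expected_log W ?f3 + expected_log W ?g))"
    by (subst expected_log_mult, blast intro: pos mult_pos_pos)+ (rule refl)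
  finally show ?thesis
    by (simp add: TIN_sum_rate_def mi_joint_law expected_log_def p_def case_prod_beta)
qed

text \<open>Supplies the mass comparison for Gibbs' inequality. For each letter the products of
  marginals sum to \<open>mass c ^ 3\<close>, leaving \<open>mass c / 8\<close>; if the mass is 0,
  division by zero gives 0 on both sides.\<close>

lemma sum_joint_law_product:
  fixes W :: "('y::finite) mac3"
  shows "(\<Sum>(i, j, k, y)\<in>UNIV. marg1 (slice W y) i * marg2 (slice W y) j * marg3 (slice W y) k /
      (8 * (mass (slice W y))\<^sup>2)) = (\<Sum>(i, j, k, y)\<in>UNIV. pmf (W i j k) y / 8)"
proof -
  have swap: "(\<Sum>(i, j, k, y)\<in>UNIV. f i j k y) =
      (\<Sum>y\<in>UNIV. \<Sum>i\<in>UNIV. \<Sum>j\<in>UNIV. \<Sum>k\<in>UNIV. f i j k y)"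
    for f :: "bool \<Rightarrow> bool \<Rightarrow> bool \<Rightarrow> 'y \<Rightarrow> real"
    unfolding UNIV_Times_UNIV[symmetric] sum.cartesian_product[symmetric]
    by (simp add: UNIV_bool sum.distrib)
  have "(\<Sum>i\<in>UNIV. \<Sum>j\<in>UNIV. \<Sum>k\<in>UNIV.
      marg1 c i * marg2 c j * marg3 c k / (8 * (mass c)\<^sup>2)) = mass c / 8" for c
    unfolding sum_divide_distrib[symmetric] sum_product_marg
    by (simp add: power2_eq_square power3_eq_cube)
  then show ?thesis
    unfolding swap by (simp add: mass_def sum_divide_distrib)
qed

lemma sum_rates:
  fixes W :: "('y::finite) mac3"
  shows TIN_le_SC: "TIN_sum_rate W \<le> SC_sum_rate W"
    and TIN_eq_SC_iff: "TIN_sum_rate W = SC_sum_rate W \<longleftrightarrow> (\<forall>y. product_table (slice W y))"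
proof -
  define p where "p = (\<lambda>(i, j, k, y). pmf (W i j k) y / 8)"
  define r where "r = (\<lambda>(i, j, k, y). marg1 (slice W y) i * marg2 (slice W y) j * marg3 (slice W y) k /
      (8 * (mass (slice W y))\<^sup>2))"
  have gap: "SC_sum_rate W - TIN_sum_rate W = (\<Sum>\<omega>\<in>UNIV. p \<omega> * log 2 (p \<omega> / r \<omega>))"
    unfolding p_def r_def by (rule sum_rate_gap)
  have nn: "0 \<le> p \<omega>" "0 \<le> r \<omega>" for \<omega>
    by (auto simp: p_def r_def marg_defs split: prod.splits
        intro!: sum_nonneg divide_nonneg_nonneg mult_nonneg_nonneg)
  \<comment> \<open>Absolute continuity: a positive entry makes every marginal through it
    positive.\<close>
  have ac: "0 < r \<omega>" if "0 < p \<omega>" for \<omega>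
  proof (cases \<omega>)
    case (fields i j k y)
    then have "0 < pmf (W i j k) y" using that by (simp add: p_def)
    then show ?thesis using slice_pos[of W i j k y] by (simp add: fields r_def)
  qed
  have le: "sum r UNIV \<le> sum p UNIV"
    using sum_joint_law_product[of W] by (simp add: p_def r_def)
  \<comment> \<open>Equality of the laws at a point is the product-table identity there; for a
    letter of mass 0 both hold, as \<open>r\<close> is 0 too.\<close>
  have iff: "p (i, j, k, y) = r (i, j, k, y) \<longleftrightarrow> pmf (W i j k) y * (mass (slice W y))\<^sup>2 =
      marg1 (slice W y) i * marg2 (slice W y) j * marg3 (slice W y) k" for i j k y
  proof (cases "mass (slice W y) = 0")
    case True
    then have "slice W y = (\<lambda>_ _ _. 0)" by (simp add: mass_eq_0_iff fun_eq_iff)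
    then have "pmf (W i j k) y = 0" "marg1 (slice W y) i = 0"
      by (auto simp: fun_eq_iff marg1_def)
    then show ?thesis by (simp add: p_def r_def)
  qed (simp add: p_def r_def field_simps)
  show "TIN_sum_rate W \<le> SC_sum_rate W"
    using gibbs_inequality[of 2 UNIV p r, OF _ _ nn ac le] gap by simp
  have "TIN_sum_rate W = SC_sum_rate W \<longleftrightarrow> (\<forall>\<omega>. p \<omega> = r \<omega>)"
    using gibbs_equality[of 2 UNIV p r, OF _ _ nn ac le] gap by auto
  then show "TIN_sum_rate W = SC_sum_rate W \<longleftrightarrow> (\<forall>y. product_table (slice W y))"
    by (auto simp: product_table_def iff)
qed

section \<open>Coincidence of the two regions\<close>

text \<open>Once slices and pair marginals factor, the conditioning marginal cancels, leaving the
  single-user density or a product of two of them.\<close>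

lemma cmi_product_table:
  fixes W :: "('y::finite) mac3"
  assumes "\<And>y. product_table (slice W y)"
  shows "cmi (joint_law W) X1 Y (pair_rv X2 X3) = mi (joint_law W) X1 Y"
    and "cmi (joint_law W) X2 Y (pair_rv X1 X3) = mi (joint_law W) X2 Y"
    and "cmi (joint_law W) X3 Y (pair_rv X1 X2) = mi (joint_law W) X3 Y"
    and "cmi (joint_law W) (pair_rv X1 X2) Y X3 = mi (joint_law W) X1 Y + mi (joint_law W) X2 Y"
    and "cmi (joint_law W) (pair_rv X1 X3) Y X2 = mi (joint_law W) X1 Y + mi (joint_law W) X3 Y"
    and "cmi (joint_law W) (pair_rv X2 X3) Y X1 = mi (joint_law W) X2 Y + mi (joint_law W) X3 Y"
proof -
  let ?c = "\<lambda>i j k y. slice W y i j k"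
  let ?t = "\<lambda>y. mass (slice W y)" and ?m1 = "\<lambda>y. marg1 (slice W y)"
    and ?m2 = "\<lambda>y. marg2 (slice W y)" and ?m3 = "\<lambda>y. marg3 (slice W y)"
  have c: "slice W y i j k = ?m1 y i * ?m2 y j * ?m3 y k / (?t y)\<^sup>2"
      "marg12 (slice W y) i j = ?m1 y i * ?m2 y j / ?t y"
      "marg13 (slice W y) i k = ?m1 y i * ?m3 y k / ?t y"
      "marg23 (slice W y) j k = ?m2 y j * ?m3 y k / ?t y"
    if "0 < pmf (W i j k) y" for i j k y
    using assms[of y] product_table_marg[of "slice W y"] slice_pos[of W, OF that]
    by (simp_all add: product_table_def eq_divide_eq)
  have pair: "expected_log W (\<lambda>i j k y. 2 * f i j k y / ?t y * (2 * g i j k y / ?t y)) =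
      expected_log W (\<lambda>i j k y. 2 * f i j k y / ?t y) +
      expected_log W (\<lambda>i j k y. 2 * g i j k y / ?t y)"
    if "\<And>i j k y. 0 < pmf (W i j k) y \<Longrightarrow> 0 < f i j k y \<and> 0 < g i j k y" for f g
    using that by (intro expected_log_mult) (simp add: slice_pos)
  have frac: "2 * (a * b * c / t\<^sup>2) / (b * c / t) = 2 * a / t"
      "2 * (a * b * c / t\<^sup>2) / (a * c / t) = 2 * b / t"
      "2 * (a * b * c / t\<^sup>2) / (a * b / t) = 2 * c / t"
      "4 * (a * b * c / t\<^sup>2) / c = 2 * a / t * (2 * b / t)"
      "4 * (a * b * c / t\<^sup>2) / b = 2 * a / t * (2 * c / t)"
      "4 * (a * b * c / t\<^sup>2) / a = 2 * b / t * (2 * c / t)"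
    if "0 < t" "0 < a" "0 < b" "0 < c" for a b c t :: real
    using that by (simp_all add: power2_eq_square)
  show "cmi (joint_law W) X1 Y (pair_rv X2 X3) = mi (joint_law W) X1 Y"
    unfolding mi_joint_law cmi_joint_law
    by (rule expected_log_cong, subst c(1), assumption, subst c(4), assumption, rule frac(1); rule slice_pos)
  show "cmi (joint_law W) X2 Y (pair_rv X1 X3) = mi (joint_law W) X2 Y"
    unfolding mi_joint_law cmi_joint_law
    by (rule expected_log_cong, subst c(1), assumption, subst c(3), assumption, rule frac(2); rule slice_pos)
  show "cmi (joint_law W) X3 Y (pair_rv X1 X2) = mi (joint_law W) X3 Y"
    unfolding mi_joint_law cmi_joint_law
    by (rule expected_log_cong, subst c(1), assumption, subst c(2), assumption, rule frac(3); rule slice_pos)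
  show "cmi (joint_law W) (pair_rv X1 X2) Y X3 = mi (joint_law W) X1 Y + mi (joint_law W) X2 Y"
    unfolding mi_joint_law cmi_joint_law
    by (subst pair[symmetric], simp add: slice_pos, rule expected_log_cong,
        subst c(1), assumption, rule frac(4); rule slice_pos)
  show "cmi (joint_law W) (pair_rv X1 X3) Y X2 = mi (joint_law W) X1 Y + mi (joint_law W) X3 Y"
    unfolding mi_joint_law cmi_joint_law
    by (subst pair[symmetric], simp add: slice_pos, rule expected_log_cong,
        subst c(1), assumption, rule frac(5); rule slice_pos)
  show "cmi (joint_law W) (pair_rv X2 X3) Y X1 = mi (joint_law W) X2 Y + mi (joint_law W) X3 Y"
    unfolding mi_joint_law cmi_joint_law
    by (subst pair[symmetric], simp add: slice_pos, rule expected_log_cong,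
        subst c(1), assumption, rule frac(6); rule slice_pos)
qed

text \<open>Every bound of the SC region is now a sum of single-user bounds, so the pair and triple
  constraints follow by adding the single ones.\<close>

lemma regions_eq:
  fixes W :: "('y::finite) mac3"
  assumes "TIN_sum_rate W = SC_sum_rate W"
  shows "TIN_region W = SC_region W"
proof -
  have "\<And>y. product_table (slice W y)"
    using assms TIN_eq_SC_iff by blast
  note cmi_product_table[OF this]
  moreover have "mi (joint_law W) (pair_rv X1 (pair_rv X2 X3)) Y =
      mi (joint_law W) X1 Y + mi (joint_law W) X2 Y + mi (joint_law W) X3 Y"
    using assms by (simp add: TIN_sum_rate_def SC_sum_rate_def)
  ultimately show ?thesis
    unfolding TIN_region_def SC_region_def by auto
qed

lemma axis_parallel_box_TIN_region:
  fixes W :: "('y::finite) mac3"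
  shows "axis_parallel_box (TIN_region W)"
proof -
  let ?u = "(mi (joint_law W) X1 Y, mi (joint_law W) X2 Y, mi (joint_law W) X3 Y)"
  have "TIN_region W = cbox (0, 0, 0) ?u"
    by (auto simp: TIN_region_def cbox_Pair_eq)
  \<comment> \<open>Nonnegativity of mutual information keeps the box nonempty; a vanishing one
    gives a side of length 0.\<close>
  moreover have "(0, 0, 0) \<in> TIN_region W"
    by (simp add: TIN_region_def mi_nonneg)
  ultimately show ?thesis
    unfolding axis_parallel_box_def by blast
qed

section \<open>The polynomial conditions\<close>

text \<open>The last binary digit of the index is the third input, so even indices sum to
  \<open>marg3\<close> at \<open>False\<close> and odd ones to \<open>marg3\<close> at
  \<open>True\<close>. Adding \<open>p 7 * p 6\<close>, \<open>p 5 * p 4\<close>,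
  \<open>p 3 * p 2\<close>, \<open>p 1 * p 0\<close> to the last four equations gives the odds
  conditions of \<open>product_table_iff\<close>.\<close>

lemma product_table_slice_iff:
  "product_table (slice W y) \<longleftrightarrow>
    (let p = \<lambda>k. trans_prob W k y in
      (p 7 + p 6) * (p 1 + p 0) = (p 5 + p 4) * (p 3 + p 2) \<and>
      p 7 * (p 4 + p 2 + p 0) = p 6 * (p 5 + p 3 + p 1) \<and>
      p 5 * (p 6 + p 2 + p 0) = p 4 * (p 7 + p 3 + p 1) \<and>
      p 3 * (p 6 + p 4 + p 0) = p 2 * (p 7 + p 5 + p 1) \<and>
      p 1 * (p 6 + p 4 + p 2) = p 0 * (p 7 + p 5 + p 3))"
proof -
  have p: "trans_prob W 7 y = pmf (W True True True) y" "trans_prob W 6 y = pmf (W True True False) y"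
    "trans_prob W 5 y = pmf (W True False True) y" "trans_prob W 4 y = pmf (W True False False) y"
    "trans_prob W 3 y = pmf (W False True True) y" "trans_prob W 2 y = pmf (W False True False) y"
    "trans_prob W 1 y = pmf (W False False True) y" "trans_prob W 0 y = pmf (W False False False) y"
    by (simp_all add: trans_prob_def bit_iff_odd)
  show ?thesis
    unfolding product_table_iff[of "slice W y", OF pmf_nonneg] all_bool_eq Let_def p
    by (auto simp: marg12_def marg3_def UNIV_bool algebra_simps)
qed

theorem theorem15:
  fixes q :: nat and s :: "nat \<Rightarrow> 'y::finite" and W :: "'y mac3"
    and p :: "nat \<Rightarrow> 'y \<Rightarrow> real"
  assumes "q \<ge> 1" and "bij_betw s {..<q} (UNIV :: 'y set)"
  defines "p \<equiv> trans_prob W"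
  shows "TIN_sum_rate W \<le> SC_sum_rate W \<and>
    (TIN_sum_rate W = SC_sum_rate W \<longleftrightarrow>
      (\<forall>j<q.
        (p 7 (s j) + p 6 (s j)) * (p 1 (s j) + p 0 (s j)) =
          (p 5 (s j) + p 4 (s j)) * (p 3 (s j) + p 2 (s j)) \<and>
        p 7 (s j) * (p 4 (s j) + p 2 (s j) + p 0 (s j)) =
          p 6 (s j) * (p 5 (s j) + p 3 (s j) + p 1 (s j)) \<and>
        p 5 (s j) * (p 6 (s j) + p 2 (s j) + p 0 (s j)) =
          p 4 (s j) * (p 7 (s j) + p 3 (s j) + p 1 (s j)) \<and>
        p 3 (s j) * (p 6 (s j) + p 4 (s j) + p 0 (s j)) =
          p 2 (s j) * (p 7 (s j) + p 5 (s j) + p 1 (s j)) \<and>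
        p 1 (s j) * (p 6 (s j) + p 4 (s j) + p 2 (s j)) =
          p 0 (s j) * (p 7 (s j) + p 5 (s j) + p 3 (s j)))) \<and>
    (TIN_sum_rate W = SC_sum_rate W \<longrightarrow>
      TIN_region W = SC_region W \<and> axis_parallel_box (TIN_region W))"
proof -
  \<comment> \<open>As \<open>s\<close> enumerates the whole output alphabet, conditions indexed by
    \<open>j < q\<close> range over all letters.\<close>
  have "(\<forall>j<q. P (s j)) \<longleftrightarrow> (\<forall>y. P y)" for P
    using assms(2) by (auto simp: bij_betw_def) (metis UNIV_I imageE lessThan_iff)
  from this[of "\<lambda>y. product_table (slice W y)"] have "TIN_sum_rate W = SC_sum_rate W \<longleftrightarrow> (\<forall>j<q. product_table (slice W (s j)))"
    by (simp add: TIN_eq_SC_iff)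
  note iff = this[unfolded product_table_slice_iff Let_def, folded p_def]
  show ?thesis
    using TIN_le_SC iff regions_eq axis_parallel_box_TIN_region by (intro conjI impI)
qed

end
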